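(* Let $r \geq 2$ be an integer, let $X = (V, \mu)$ be a weighted $r$-uniform hypergraph, and let $H$ be its underlying hypergraph. Then \[ \alpha(X) \leq \vartheta(H, \mu^{(1)}) \leq \mathrm{Hoff}(X). \]
   Context: Hypergraphs and theta number. For an integer $r \geq 1$, an $r$-uniform hypergraph $H=(V,E)$ consists of a finite set $V$ and a set $E \subseteq \binom{V}{r}$, where $\binom{V}{r}$ is the set of $r$-element subsets of $V$. A set $I \subseteq V$ is independent in $H$ if no edge of $H$ is contained in $I$. For $w \in \mathbb{R}^V$, $\alpha(H,w) = \max\{ \sum_{x\in I} w(x) : I \subseteq V \text{ independent}\}$. $\mathrm{IND}(H) = \mathrm{conv}\{\chi_I \in \mathbb{R}^V : I \subseteq V \text{ independent}\}$, where $\chi_I$ is the characteristic function of $I$. For $r \geq 2$ and $x \in V$, the link of $x$ in $H$ is the $(r-1)$-uniform hypergraph $H_x$ with vertex set $V_x = \{ y \in V \setminus\{x\} : \text{there is } e \in E \text{ containing } x \text{ and } y\}$, in which an $(r-1)$-subset $e$ of $V_x$ is an edge if and only if $e \cup \{x\} \in E$. For $A \in \mathbb{R}^{V\times V}$, $A_x$ is the row indexed by $x$; $f[U]$ is the restriction of $f$ to $U$. Positive semidefinite matrices are always symmetric. For a symmetric matrix $A$ with diagonal $a$, write $R(A) = \begin{pmatrix} 1 & a^{\mathsf T} \\ a & A\end{pmatrix}$. The theta body is defined recursively: for $r=1$, $\mathrm{TH}(H) = \mathrm{IND}(H)$; for $r \geq 2$, $\mathrm{TH}(H)$ is the set of all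 $f \in \mathbb{R}^V$ for which there is $F \in \mathbb{R}^{V\times V}$ such that $f = \mathrm{diag}\,F$, $F_x[V_x] \in F(x,x)\,\mathrm{TH}(H_x)$ for every $x \in V$ (no constraint on row $F_x$ if the link $H_x$ is empty), and $R(F)$ is positive semidefinite. The theta number is $\vartheta(H,w) = \max\{ w^{\mathsf T}f : f \in \mathrm{TH}(H)\}$. Weighted hypergraphs. A weighted $r$-uniform hypergraph is a pair $X = (V,\mu)$ with $V$ a finite set and $\mu$ a probability measure on $\binom{V}{r}$. Its underlying hypergraph is the $r$-uniform hypergraph on $V$ whose edge set $E$ is the support of $\mu$. For $1 \leq i \leq r$, $\mu^{(i)}$ is the probability measure on $\binom{V}{i}$ given by $\mu^{(i)}(\sigma) = \binom{r}{i}^{-1}\mu(\{e \in E : \sigma \subseteq e\})$, and $X^{(i)}$ is the support of $\mu^{(i)}$. The measure $\mu^{(1)}$ is regarded as a weight function on $V$, and $\alpha(X) = \alpha(H, \mu^{(1)})$. Standing assumption: $X^{(1)} = V$ (there are no isolated vertices). For $\sigma \in X^{(i)}$ with $i\le r-1$, the link of $\sigma$ (an $i$-link of $X$) is the weighted $(r-i)$-uniform hypergraph $X_\sigma = (V,\mu_\sigma)$ with $\mu_\sigma(e) = \mu(e \cup \sigma)/\mu(\{e' \in E : \sigma \subseteq e'\})$ for $e \in \binom{V \setminus \sigma}{r-i}$ (and $\mu_\sigma(e)=0$ for $e$ meeting $\sigma$). Vertices outside the support of $\mu_\sigma^{(1)}$ (isolated vertices of the link) are discarded, so that the assumption above holds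 for $X_\sigma$ as well. Write $X_x = X_{\{x\}}$, $\mu_x = \mu_{\{x\}}$ and $\mu_x^{(1)} = (\mu_x)^{(1)}$. For $r\ge 2$, the normalized adjacency operator of $X$ is the operator $T_X$ on $\mathbb{R}^V$ given by $(T_X f)(x) = \sum_{y \in V} f(y)\,\mu_x^{(1)}(y)$ (with $\mu_x^{(1)}(y)=0$ off the support). It is self-adjoint with respect to the inner product $(f,g) = \sum_{x \in V} f(x)g(x)\mu^{(1)}(x)$, hence has real eigenvalues; $\lambda(X)$ denotes its smallest eigenvalue. Set $\lambda_0(X) = \lambda(X)$ and, for $i = 1,\dots,r-2$, $\lambda_i(X) = \min_{\sigma \in X^{(i)}} \lambda(X_\sigma)$. The Hoffman bound of $X$ is \[ \mathrm{Hoff}(X) = 1 - \frac{1}{(1-\lambda_0(X))(1-\lambda_1(X))\cdots(1-\lambda_{r-2}(X))}. \] *)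

theory Defs
  imports "HOL-Analysis.Analysis" "HOL-Library.Ramsey"
begin

text \<open>
  Hypergraphs live on a subset V of a finite type. A vector indexed by a subset U of the
  type is represented by the vector over the whole type that is 0 outside U, and likewise for
  matrices. An r-uniform hypergraph is given by r, V and E with E a subset of nsets V r, the
  set of r-element subsets of V.
\<close>

section \<open>Hypergraphs and the theta number\<close>

definition indep_set :: "'a set \<Rightarrow> 'a set set \<Rightarrow> 'a set \<Rightarrow> bool" where
  "indep_set V E I \<longleftrightarrow> I \<subseteq> V \<and> (\<forall>e\<in>E. \<not> e \<subseteq> I)"

definition independence_number :: "'a::finite set \<Rightarrow> 'a set set \<Rightarrow> real ^ 'a \<Rightarrow> real" where
  "independence_number V E w = Max ((\<lambda>I. \<Sum>x\<in>I. w $ x) ` {I. indep_set V E I})"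

definition char_vec :: "'a::finite set \<Rightarrow> real ^ 'a" where
  "char_vec I = (\<chi> x. indicator I x)"

definition IND :: "'a::finite set \<Rightarrow> 'a set set \<Rightarrow> (real ^ 'a) set" where
  "IND V E = convex hull (char_vec ` {I. indep_set V E I})"

definition link_verts :: "'a set \<Rightarrow> 'a set set \<Rightarrow> 'a \<Rightarrow> 'a set" where
  "link_verts V E x = {y \<in> V - {x}. \<exists>e\<in>E. x \<in> e \<and> y \<in> e}"

definition link_edges :: "nat \<Rightarrow> 'a set \<Rightarrow> 'a set set \<Rightarrow> 'a \<Rightarrow> 'a set set" where
  "link_edges r V E x = {e \<in> nsets (link_verts V E x) (r - 1). insert x e \<in> E}"

definition vec_restrict :: "real ^ 'a::finite \<Rightarrow> 'a set \<Rightarrow> real ^ 'a" where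
  "vec_restrict f U = (\<chi> y. if y \<in> U then f $ y else 0)"

definition pos_semidef :: "real ^ 'n ^ 'n::finite \<Rightarrow> bool" where
  "pos_semidef A \<longleftrightarrow> transpose A = A \<and> (\<forall>v. 0 \<le> v \<bullet> (A *v v))"

text \<open>The bordered matrix R(A); its additional row and column have index None.\<close>

definition bordered :: "real ^ 'a ^ 'a::finite \<Rightarrow> real ^ 'a option ^ 'a option" where
  "bordered A = (\<chi> i j.
     (case (i, j) of
        (None, None) \<Rightarrow> 1
      | (None, Some y) \<Rightarrow> A $ y $ y
      | (Some x, None) \<Rightarrow> A $ x $ x
      | (Some x, Some y) \<Rightarrow> A $ x $ y))"

text \<open>The theta body. Uniformity 0 is not meaningful; the first equation is a dummy value.\<close>

fun TH :: "nat \<Rightarrow> 'a::finite set \<Rightarrow> 'a set set \<Rightarrow> (real ^ 'a) set" where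
  "TH 0 V E = {}"
| "TH (Suc 0) V E = IND V E"
| "TH (Suc (Suc k)) V E =
     {f. \<exists>F :: real ^ 'a ^ 'a.
        (\<forall>x y. x \<notin> V \<or> y \<notin> V \<longrightarrow> F $ x $ y = 0) \<and>
        f = (\<chi> x. F $ x $ x) \<and>
        (\<forall>x\<in>V. link_verts V E x \<noteq> {} \<longrightarrow>
           vec_restrict (F $ x) (link_verts V E x)
             \<in> (\<lambda>g. (F $ x $ x) *\<^sub>R g)
                  ` TH (Suc k) (link_verts V E x) (link_edges (Suc (Suc k)) V E x)) \<and>
        pos_semidef (bordered F)}"

definition theta_number :: "nat \<Rightarrow> 'a::finite set \<Rightarrow> 'a set set \<Rightarrow> real ^ 'a \<Rightarrow> real" where
  "theta_number r V E w = (GREATEST t. \<exists>f \<in> TH r V E. t = w \<bullet> f)"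


section \<open>Weighted hypergraphs and the Hoffman bound\<close>

text \<open>The probability measure on nsets V r is given by its point masses.\<close>

definition weighted_hypergraph :: "nat \<Rightarrow> 'a set \<Rightarrow> ('a set \<Rightarrow> real) \<Rightarrow> bool" where
  "weighted_hypergraph r V \<mu> \<longleftrightarrow>
     finite V \<and> (\<forall>e. 0 \<le> \<mu> e) \<and> (\<forall>e. e \<notin> nsets V r \<longrightarrow> \<mu> e = 0) \<and> (\<Sum>e\<in>nsets V r. \<mu> e) = 1"

definition edges :: "('a set \<Rightarrow> real) \<Rightarrow> 'a set set" where
  "edges \<mu> = {e. \<mu> e \<noteq> 0}"

definition level_measure ::
    "nat \<Rightarrow> 'a set \<Rightarrow> ('a set \<Rightarrow> real) \<Rightarrow> nat \<Rightarrow> 'a set \<Rightarrow> real" where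
  "level_measure r V \<mu> i \<sigma> =
     (if \<sigma> \<in> nsets V i
      then (\<Sum>e\<in>{e \<in> edges \<mu>. \<sigma> \<subseteq> e}. \<mu> e) / real (r choose i) else 0)"

definition level :: "nat \<Rightarrow> 'a set \<Rightarrow> ('a set \<Rightarrow> real) \<Rightarrow> nat \<Rightarrow> 'a set set" where
  "level r V \<mu> i = {\<sigma>. level_measure r V \<mu> i \<sigma> \<noteq> 0}"

definition vertex_weight :: "nat \<Rightarrow> 'a::finite set \<Rightarrow> ('a set \<Rightarrow> real) \<Rightarrow> real ^ 'a" where
  "vertex_weight r V \<mu> = (\<chi> x. level_measure r V \<mu> 1 {x})"

definition nonisolated :: "nat \<Rightarrow> 'a set \<Rightarrow> ('a set \<Rightarrow> real) \<Rightarrow> 'a set" where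
  "nonisolated r V \<mu> = {x. {x} \<in> level r V \<mu> 1}"

definition alpha :: "nat \<Rightarrow> 'a::finite set \<Rightarrow> ('a set \<Rightarrow> real) \<Rightarrow> real" where
  "alpha r V \<mu> = independence_number V (edges \<mu>) (vertex_weight r V \<mu>)"

definition link_measure ::
    "nat \<Rightarrow> 'a set \<Rightarrow> ('a set \<Rightarrow> real) \<Rightarrow> 'a set \<Rightarrow> 'a set \<Rightarrow> real" where
  "link_measure r V \<mu> \<sigma> e =
     (if e \<in> nsets (V - \<sigma>) (r - card \<sigma>)
      then \<mu> (e \<union> \<sigma>) / (\<Sum>e'\<in>{e' \<in> edges \<mu>. \<sigma> \<subseteq> e'}. \<mu> e') else 0)"

text \<open>The operator acts on vectors that vanish outside V (see is_eigenvalue).\<close>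

definition adj_op ::
    "nat \<Rightarrow> 'a::finite set \<Rightarrow> ('a set \<Rightarrow> real) \<Rightarrow> real ^ 'a \<Rightarrow> real ^ 'a" where
  "adj_op r V \<mu> f =
     (\<chi> x. if x \<in> V
           then \<Sum>y\<in>V. f $ y * level_measure (r - 1) V (link_measure r V \<mu> {x}) 1 {y} else 0)"

definition is_eigenvalue :: "nat \<Rightarrow> 'a::finite set \<Rightarrow> ('a set \<Rightarrow> real) \<Rightarrow> real \<Rightarrow> bool" where
  "is_eigenvalue r V \<mu> t \<longleftrightarrow>
     (\<exists>f. f \<noteq> 0 \<and> (\<forall>x. x \<notin> V \<longrightarrow> f $ x = 0) \<and> adj_op r V \<mu> f = t *\<^sub>R f)"

definition smallest_eigenvalue :: "nat \<Rightarrow> 'a::finite set \<Rightarrow> ('a set \<Rightarrow> real) \<Rightarrow> real" where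
  "smallest_eigenvalue r V \<mu> = (LEAST t. is_eigenvalue r V \<mu> t)"

text \<open>The link of a set has uniformity r - card and only the non-isolated vertices.\<close>

definition link_smallest_eigenvalue ::
    "nat \<Rightarrow> 'a::finite set \<Rightarrow> ('a set \<Rightarrow> real) \<Rightarrow> 'a set \<Rightarrow> real" where
  "link_smallest_eigenvalue r V \<mu> \<sigma> =
     (let s = r - card \<sigma>; \<nu> = link_measure r V \<mu> \<sigma>
      in smallest_eigenvalue s (nonisolated s V \<nu>) \<nu>)"

definition link_lambda :: "nat \<Rightarrow> 'a::finite set \<Rightarrow> ('a set \<Rightarrow> real) \<Rightarrow> nat \<Rightarrow> real" where
  "link_lambda r V \<mu> i =
     (if i = 0 then smallest_eigenvalue r V \<mu>
      else Min (link_smallest_eigenvalue r V \<mu> ` level r V \<mu> i))"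

definition Hoff :: "nat \<Rightarrow> 'a::finite set \<Rightarrow> ('a set \<Rightarrow> real) \<Rightarrow> real" where
  "Hoff r V \<mu> = 1 - 1 / (\<Prod>i\<in>{0..r - 2}. 1 - link_lambda r V \<mu> i)"

end

theory Submission
  imports Defs
begin

text \<open>
  The lower bound holds because the characteristic vector of an independent set I lies in the
  theta body: the rank-one matrix with entries \<open>\<chi>\<^sub>I x * \<chi>\<^sub>I y\<close> is a witness, and its row at x in I
  restricts on the link of x to the characteristic vector of a set that is independent there
  (\<open>char_vec_in_TH\<close>).  The theta number is defined as a greatest element, so it also has to
  be shown that the maximum is attained; this follows from compactness of the theta body
  (\<open>compact_TH\<close>): F has entries in [-1, 1] whenever the bordered matrix R(F) is positive semidefinite.

  The upper bound is proved by induction on the uniformity r (\<open>TH_le_hoffman\<close>).  Let w be the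
  vertex weights, let \<open>K x y\<close> be the weight of x times the weight of y in the link of x, and let
  F be a matrix that witnesses membership of f in the theta body; put \<open>t = \<Sum>x. w x * F x x\<close>,
  which is the inner product of w and f.  The sum \<open>\<Sum>x y. K x y * F x y\<close> is estimated twice.
  By induction applied to the link of x, row x contributes at most h times \<open>w x * F x x\<close>, where
  1 - h is the inverse of \<open>(1 - \<lambda>\<^sub>1) ... (1 - \<lambda>\<^sub>r\<^sub>-\<^sub>2)\<close>; this uses that the links of a link are links
  and that all the \<open>\<lambda>\<^sub>i\<close> are nonpositive, so that the bound of a link is at most h.  Hence the sum is
  at most h t.  On the other hand K is the matrix of the quadratic form of the adjacency operator,
  the constant functions are eigenvectors with eigenvalue 1, and on their orthogonal complement
  the form is at least \<open>\<lambda>\<^sub>0\<close> times the squared norm.  So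
  \<open>K x y - \<lambda>\<^sub>0 * w x * [x = y] - (1 - \<lambda>\<^sub>0) * w x * w y\<close> is positive semidefinite, and its trace product
  with F is nonnegative.  As \<open>\<Sum>x y. w x * w y * F x y\<close> is at least t squared by positivity of the
  bordered matrix, the sum is at least \<open>\<lambda>\<^sub>0 t + (1 - \<lambda>\<^sub>0) t\<^sup>2\<close>.  Comparing the two estimates gives
  \<open>t \<le> 1 - (1 - h) / (1 - \<lambda>\<^sub>0)\<close>, the Hoffman bound (\<open>hoffman_bound_step\<close>).

  Two facts of linear algebra support this: the trace product of two positive semidefinite forms
  is nonnegative (\<open>trace_product_nonneg\<close>, by elimination of pivots), and the least eigenvalue of
  a self-adjoint operator exists and bounds its Rayleigh quotient from below
  (\<open>least_eigenvalue_rayleigh\<close>).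
\<close>

section \<open>Positive semidefinite matrices\<close>

lemma pos_semidef_iff:
  "pos_semidef A \<longleftrightarrow> (\<forall>x y. A $ x $ y = A $ y $ x)
     \<and> (\<forall>v. 0 \<le> (\<Sum>x\<in>UNIV. \<Sum>y\<in>UNIV. A $ x $ y * (v x * v y)))"
proof -
  have "(transpose A = A) \<longleftrightarrow> (\<forall>x y. A $ x $ y = A $ y $ x)"
    by (auto simp: transpose_def vec_eq_iff)
  moreover have form: "v \<bullet> (A *v v) = (\<Sum>x\<in>UNIV. \<Sum>y\<in>UNIV. A $ x $ y * (v $ x * v $ y))" for v
    by (simp add: inner_vec_def matrix_vector_mult_def sum_distrib_left algebra_simps)
  moreover have "(\<forall>v. 0 \<le> v \<bullet> (A *v v))
      \<longleftrightarrow> (\<forall>v. 0 \<le> (\<Sum>x\<in>UNIV. \<Sum>y\<in>UNIV. A $ x $ y * (v x * v y)))"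
  proof (intro iffI allI)
    fix v
    assume "\<forall>v. 0 \<le> v \<bullet> (A *v v)"
    from this[rule_format, of "\<chi> x. v x"]
    show "0 \<le> (\<Sum>x\<in>UNIV. \<Sum>y\<in>UNIV. A $ x $ y * (v x * v y))"
      by (simp add: form)
  next
    fix v :: "real ^ 'a"
    assume "\<forall>v. 0 \<le> (\<Sum>x\<in>UNIV. \<Sum>y\<in>UNIV. A $ x $ y * (v x * v y))"
    then show "0 \<le> v \<bullet> (A *v v)" by (simp add: form)
  qed
  ultimately show ?thesis by (simp add: pos_semidef_def)
qed

lemma sum_UNIV_option:
  fixes f :: "'a::finite option \<Rightarrow> real"
  shows "(\<Sum>i\<in>UNIV. f i) = f None + (\<Sum>x\<in>UNIV. f (Some x))"
  by (simp add: UNIV_option_conv sum.reindex)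

lemma pos_semidef_bordered_iff:
  "pos_semidef (bordered F) \<longleftrightarrow> (\<forall>x y. F $ x $ y = F $ y $ x)
     \<and> (\<forall>c v. 0 \<le> c\<^sup>2 + 2 * c * (\<Sum>x\<in>UNIV. F $ x $ x * v x)
                   + (\<Sum>x\<in>UNIV. \<Sum>y\<in>UNIV. F $ x $ y * (v x * v y)))"
proof -
  have form: "(\<Sum>i\<in>UNIV. \<Sum>j\<in>UNIV. bordered F $ i $ j * (u i * u j)) =
      (u None)\<^sup>2 + 2 * u None * (\<Sum>x\<in>UNIV. F $ x $ x * u (Some x))
        + (\<Sum>x\<in>UNIV. \<Sum>y\<in>UNIV. F $ x $ y * (u (Some x) * u (Some y)))" for u
    by (simp add: sum_UNIV_option bordered_def sum.distrib sum_distrib_left power2_eq_square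
        algebra_simps)
  have sym: "(\<forall>i j. bordered F $ i $ j = bordered F $ j $ i) \<longleftrightarrow> (\<forall>x y. F $ x $ y = F $ y $ x)"
    by (auto simp: bordered_def split: option.split)
  have all: "(\<forall>u. P (u None) (\<lambda>x. u (Some x))) \<longleftrightarrow> (\<forall>c v. P c v)"
    for P :: "real \<Rightarrow> ('a \<Rightarrow> real) \<Rightarrow> bool"
  proof (intro iffI allI)
    fix c v assume "\<forall>u. P (u None) (\<lambda>x. u (Some x))"
    from this[rule_format, of "\<lambda>i. case i of None \<Rightarrow> c | Some x \<Rightarrow> v x"]
    show "P c v" by simp
  qed simp
  show ?thesis
    unfolding pos_semidef_iff form sym
    using all[of "\<lambda>c v. 0 \<le> c\<^sup>2 + 2 * c * (\<Sum>x\<in>UNIV. F $ x $ x * v x)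
                   + (\<Sum>x\<in>UNIV. \<Sum>y\<in>UNIV. F $ x $ y * (v x * v y))"]
    by simp
qed

text \<open>
  Near s = 0 the linear term dominates, so it would make the polynomial negative on one side of 0.
\<close>

lemma nonneg_quadratic_imp_linear_coeff_zero:
  fixes b c :: real
  assumes "\<And>s. 0 \<le> 2 * s * b + s\<^sup>2 * c"
  shows "b = 0"
proof (rule ccontr)
  assume "b \<noteq> 0"
  define k where "k = \<bar>c\<bar> + 1"
  have "k > 0" "c < k" by (auto simp: k_def)
  have "0 \<le> 2 * (- b / k) * b + (- b / k)\<^sup>2 * c" by (rule assms)
  also have "\<dots> = (b / k)\<^sup>2 * (c - 2 * k)"
    using \<open>k > 0\<close> by (simp add: field_simps power2_eq_square)
  also have "\<dots> < 0"
    using \<open>b \<noteq> 0\<close> \<open>k > 0\<close> \<open>c < k\<close> by (intro mult_pos_neg) auto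
  finally show False by simp
qed

lemma pos_semidef_symD: "pos_semidef A \<Longrightarrow> A $ x $ y = A $ y $ x"
  by (simp add: pos_semidef_iff)

text \<open>
  The quadratic form of A at v plus s times the unit vector at x.  The choices of
  s and v below yield all the inequalities between the entries of A that the proof uses.
\<close>

lemma sum_two_deltas:
  fixes A :: "'a::finite \<Rightarrow> 'a \<Rightarrow> real"
  shows "(\<Sum>i\<in>UNIV. \<Sum>j\<in>UNIV. A i j * ((v i + (if i = x then s else 0)) * (v j + (if j = x then s else 0))))
    = (\<Sum>i\<in>UNIV. \<Sum>j\<in>UNIV. A i j * (v i * v j)) + s * (\<Sum>j\<in>UNIV. A x j * v j)
       + s * (\<Sum>i\<in>UNIV. A i x * v i) + s\<^sup>2 * A x x"
proof -
  have "(\<Sum>j\<in>UNIV. A i j * ((v i + (if i = x then s else 0)) * (v j + (if j = x then s else 0)))) =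
     (\<Sum>j\<in>UNIV. A i j * (v i * v j)) + s * (A i x * v i) +
      (if i = x then s * (\<Sum>j\<in>UNIV. A x j * v j) + s\<^sup>2 * A x x else 0)" for i
  proof -
    have "A i j * ((v i + (if i = x then s else 0)) * (v j + (if j = x then s else 0))) =
      A i j * (v i * v j) + (if j = x then A i x * v i * s else 0)
       + (if i = x then s * (A x j * v j) else 0) + (if j = x then (if i = x then s\<^sup>2 * A x x else 0) else 0)" for j
      by (auto simp: algebra_simps power2_eq_square)
    then show ?thesis
      by (simp add: sum.distrib sum_distrib_left)
  qed
  then show ?thesis
    by (simp add: sum.distrib sum_distrib_left)
qed

lemma pos_semidef_shift:
  assumes "pos_semidef A"
  shows "0 \<le> (\<Sum>i\<in>UNIV. \<Sum>j\<in>UNIV. A $ i $ j * (v i * v j)) + 2 * s * (\<Sum>j\<in>UNIV. A $ x $ j * v j)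
       + s\<^sup>2 * A $ x $ x"
proof -
  have "0 \<le> (\<Sum>i\<in>UNIV. \<Sum>j\<in>UNIV. A $ i $ j *
      ((v i + (if i = x then s else 0)) * (v j + (if j = x then s else 0))))"
    using assms by (simp add: pos_semidef_iff)
  also have "\<dots> = (\<Sum>i\<in>UNIV. \<Sum>j\<in>UNIV. A $ i $ j * (v i * v j)) + 2 * s * (\<Sum>j\<in>UNIV. A $ x $ j * v j)
       + s\<^sup>2 * A $ x $ x"
  proof -
    have "(\<Sum>i\<in>UNIV. A $ i $ x * v i) = (\<Sum>i\<in>UNIV. A $ x $ i * v i)"
      by (intro sum.cong refl arg_cong2[where f = "(*)"] pos_semidef_symD[OF assms])
    then show ?thesis unfolding sum_two_deltas by simp
  qed
  finally show ?thesis .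
qed

lemma pos_semidef_minor:
  assumes "pos_semidef A"
  shows "0 \<le> t\<^sup>2 * A $ y $ y + 2 * s * t * A $ x $ y + s\<^sup>2 * A $ x $ x"
proof -
  have [simp]: "(if i = y then t else 0) * (if j = y then t else 0) * a
     = (if i = y then if j = y then t\<^sup>2 * a else 0 else 0)" for i j :: 'a and a
    by (simp add: power2_eq_square)
  show ?thesis
    using pos_semidef_shift[OF assms, of "\<lambda>i. if i = y then t else 0" s x]
    by (simp add: sum.If_cases if_distrib[of "(*) _"] power2_eq_square algebra_simps cong: if_cong)
qed

lemma pos_semidef_diag_nonneg: "pos_semidef A \<Longrightarrow> 0 \<le> A $ x $ x"
  using pos_semidef_minor[of A 0 x 1 x] by simp

lemma pos_semidef_diag_zero:
  assumes "pos_semidef A" "A $ y $ y = 0"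
  shows "A $ x $ y = 0"
proof (rule nonneg_quadratic_imp_linear_coeff_zero)
  fix s
  show "0 \<le> 2 * s * (A $ x $ y) + s\<^sup>2 * A $ x $ x"
    using pos_semidef_minor[OF assms(1), of 1 y s x] assms(2) by simp
qed

text \<open>
  One step of symmetric Gaussian elimination.  The value of the new form at v is the minimum of
  the old form over the line through v in the direction of the unit vector at p.
\<close>

lemma pos_semidef_pivot:
  assumes A: "pos_semidef A" and p: "A $ p $ p \<noteq> 0"
  shows "pos_semidef (\<chi> x y. A $ x $ y - A $ p $ x * A $ p $ y / A $ p $ p)"
  unfolding pos_semidef_iff
proof (intro conjI allI)
  fix v :: "'a \<Rightarrow> real"
  define a where "a = (\<Sum>j\<in>UNIV. A $ p $ j * v j)"
  have sq: "(\<Sum>x\<in>UNIV. \<Sum>y\<in>UNIV. A $ p $ x * A $ p $ y / A $ p $ p * (v x * v y)) = a\<^sup>2 / A $ p $ p"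
    unfolding a_def power2_eq_square sum_product sum_divide_distrib
    by (intro sum.cong refl) simp
  have "0 \<le> (\<Sum>i\<in>UNIV. \<Sum>j\<in>UNIV. A $ i $ j * (v i * v j)) + 2 * (- a / A $ p $ p) * a
       + (- a / A $ p $ p)\<^sup>2 * A $ p $ p"
    unfolding a_def by (rule pos_semidef_shift[OF A])
  also have "\<dots> = (\<Sum>i\<in>UNIV. \<Sum>j\<in>UNIV. A $ i $ j * (v i * v j)) - a\<^sup>2 / A $ p $ p"
    using p by (simp add: field_simps power2_eq_square)
  finally show "0 \<le> (\<Sum>x\<in>UNIV. \<Sum>y\<in>UNIV.
      (\<chi> x y. A $ x $ y - A $ p $ x * A $ p $ y / A $ p $ p) $ x $ y * (v x * v y))"
    by (simp only: vec_lambda_beta left_diff_distrib sum_subtractf sq)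
qed (use pos_semidef_symD[OF A] in simp)

text \<open>
  Eliminating a pivot writes A as a nonnegative multiple of a rank-one matrix \<open>a a\<^sup>T\<close> plus a
  positive semidefinite matrix with fewer nonzero diagonal entries.  On a rank-one matrix the
  trace product with P is a value of the quadratic form P.  A matrix without a pivot is zero, because a zero
  diagonal entry forces its whole column to vanish.
\<close>

lemma trace_product_nonneg:
  fixes A :: "real ^ 'n ^ 'n::finite" and P :: "'n \<Rightarrow> 'n \<Rightarrow> real"
  assumes "pos_semidef A"
    and P: "\<And>v. 0 \<le> (\<Sum>x\<in>UNIV. \<Sum>y\<in>UNIV. P x y * (v x * v y))"
  shows "0 \<le> (\<Sum>x\<in>UNIV. \<Sum>y\<in>UNIV. P x y * A $ x $ y)"
  using assms(1)
proof (induction "card {x. A $ x $ x \<noteq> 0}" arbitrary: A rule: less_induct)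
  case less
  show ?case
  proof (cases "\<exists>p. A $ p $ p \<noteq> 0")
    case False
    then have "A $ x $ y = 0" for x y
      using pos_semidef_diag_zero[OF less.prems] by blast
    then show ?thesis by simp
  next
    case True
    then obtain p where p: "A $ p $ p \<noteq> 0" by blast
    define B :: "real ^ 'n ^ 'n"
      where "B = (\<chi> x y. A $ x $ y - A $ p $ x * A $ p $ y / A $ p $ p)"
    have "pos_semidef B"
      unfolding B_def by (rule pos_semidef_pivot[OF less.prems p])
    have "B $ x $ x = 0" if "A $ x $ x = 0" for x
      using that pos_semidef_diag_zero[OF less.prems that] by (simp add: B_def)
    moreover have "B $ p $ p = 0" using p by (simp add: B_def)
    ultimately have "{x. B $ x $ x \<noteq> 0} \<subset> {x. A $ x $ x \<noteq> 0}" using p by auto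
    then have "card {x. B $ x $ x \<noteq> 0} < card {x. A $ x $ x \<noteq> 0}"
      by (intro psubset_card_mono) auto
    then have IH: "0 \<le> (\<Sum>x\<in>UNIV. \<Sum>y\<in>UNIV. P x y * B $ x $ y)"
      using less.hyps \<open>pos_semidef B\<close> by blast
    have "(\<Sum>x\<in>UNIV. \<Sum>y\<in>UNIV. P x y * A $ x $ y) = (\<Sum>x\<in>UNIV. \<Sum>y\<in>UNIV. P x y * B $ x $ y)
        + (\<Sum>x\<in>UNIV. \<Sum>y\<in>UNIV. P x y * (A $ p $ x * A $ p $ y)) / A $ p $ p"
      unfolding sum_divide_distrib sum.distrib[symmetric]
      by (intro sum.cong refl) (simp add: B_def algebra_simps)
    moreover have "A $ p $ p \<ge> 0" by (rule pos_semidef_diag_nonneg[OF less.prems])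
    ultimately show ?thesis using IH P[of "\<lambda>x. A $ p $ x"] by simp
  qed
qed

lemma pos_semidef_bordered_imp:
  assumes "pos_semidef (bordered F)"
  shows "pos_semidef F"
  unfolding pos_semidef_iff
proof (intro conjI allI)
  fix v
  have "0 \<le> 0\<^sup>2 + 2 * 0 * (\<Sum>x\<in>UNIV. F $ x $ x * v x)
          + (\<Sum>x\<in>UNIV. \<Sum>y\<in>UNIV. F $ x $ y * (v x * v y))"
    using assms unfolding pos_semidef_bordered_iff by blast
  then show "0 \<le> (\<Sum>x\<in>UNIV. \<Sum>y\<in>UNIV. F $ x $ y * (v x * v y))" by simp
qed (use assms pos_semidef_bordered_iff in blast)

lemma pos_semidef_bordered_diag_le_1:
  assumes "pos_semidef (bordered F)"
  shows "F $ x $ x \<le> 1"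
proof -
  have "0 \<le> 1 - F $ x $ x" 
    using pos_semidef_minor[OF assms, of 1 None "-1" "Some x"] by (simp add: bordered_def)
  then show ?thesis by simp
qed

lemma pos_semidef_bordered_entry_le_1:
  assumes "pos_semidef (bordered F)"
  shows "\<bar>F $ x $ y\<bar> \<le> 1"
  using pos_semidef_minor[OF pos_semidef_bordered_imp[OF assms], of 1 y 1 x]
    pos_semidef_minor[OF pos_semidef_bordered_imp[OF assms], of 1 y "-1" x]
    pos_semidef_bordered_diag_le_1[OF assms, of x] pos_semidef_bordered_diag_le_1[OF assms, of y]
  by simp

section \<open>Compactness of the theta body and the lower bound\<close>

text \<open>
  The theta body is the image of its set of witness matrices.  That set is bounded by the previous
  lemma.  It is closed because the condition on a row asks for a vector in a compact set, namely the theta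
  body of the link, that satisfies an equation, and projections along compact sets preserve
  closedness.
\<close>

lemma compact_TH: "compact (TH r V E)"
proof (induction r V E rule: TH.induct)
  case (1 V E)
  then show ?case by simp
next
  case (2 V E)
  then show ?case by (simp add: IND_def finite_imp_compact_convex_hull)
next
  case (3 k V E)
  define L where "L x = TH (Suc k) (link_verts V E x) (link_edges (Suc (Suc k)) V E x)" for x
  define N where "N x = link_verts V E x" for x
  define \<F> where "\<F> = {F :: real ^ 'a ^ 'a.
        (\<forall>x y. x \<notin> V \<or> y \<notin> V \<longrightarrow> F $ x $ y = 0) \<and>
        (\<forall>x\<in>V. N x \<noteq> {} \<longrightarrow> vec_restrict (F $ x) (N x) \<in> (\<lambda>g. (F $ x $ x) *\<^sub>R g) ` L x) \<and>
        pos_semidef (bordered F)}"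
  have TH: "TH (Suc (Suc k)) V E = (\<lambda>F. \<chi> x. F $ x $ x) ` \<F>"
    by (auto simp: \<F>_def L_def N_def)
  have "bounded \<F>"
  proof (rule boundedI)
    fix F assume "F \<in> \<F>"
    then have *: "\<bar>F $ x $ y\<bar> \<le> 1" for x y
      using pos_semidef_bordered_entry_le_1 by (auto simp: \<F>_def)
    have "norm F \<le> (\<Sum>x\<in>UNIV. norm (F $ x))"
      unfolding norm_vec_def by (rule L2_set_le_sum) simp
    also have "\<dots> \<le> (\<Sum>x\<in>UNIV. \<Sum>y\<in>UNIV. \<bar>F $ x $ y\<bar>)"
      by (intro sum_mono norm_le_l1_cart)
    also have "\<dots> \<le> (\<Sum>x\<in>(UNIV :: 'a set). \<Sum>y\<in>(UNIV :: 'a set). 1)"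
      by (intro sum_mono *)
    finally show "norm F \<le> (\<Sum>x\<in>(UNIV :: 'a set). \<Sum>y\<in>(UNIV :: 'a set). 1)" .
  qed
  moreover have "closed \<F>"
  proof -
    have link_closed: "closed {F :: real ^ 'a ^ 'a. vec_restrict (F $ x) (N x) \<in> (\<lambda>g. (F $ x $ x) *\<^sub>R g) ` L x}"
      if "x \<in> V" "N x \<noteq> {}" for x
    proof -
      have "compact (L x)" unfolding L_def using 3 that N_def by blast
      moreover have "closed {(g, F :: real ^ 'a ^ 'a). vec_restrict (F $ x) (N x) = (F $ x $ x) *\<^sub>R g}"
        unfolding vec_eq_iff vec_restrict_def case_prod_beta
      proof (intro closed_Collect_all closed_Collect_eq)
        fix y
        show "continuous_on UNIV (\<lambda>p :: (real ^ 'a) \<times> (real ^ 'a ^ 'a).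
            (\<chi> y. if y \<in> N x then snd p $ x $ y else 0) $ y)"
          by (cases "y \<in> N x") (auto intro!: continuous_intros)
      qed (auto intro!: continuous_intros)
      ultimately have "closed {F. \<exists>g. g \<in> L x \<and>
          (g, F) \<in> {(g, F :: real ^ 'a ^ 'a). vec_restrict (F $ x) (N x) = (F $ x $ x) *\<^sub>R g}}"
        by (rule closed_compact_projection)
      then show ?thesis by (simp add: image_iff Bex_def)
    qed
    have "closed {F :: real ^ 'a ^ 'a. x \<notin> V \<or> y \<notin> V \<longrightarrow> F $ x $ y = 0}" for x y
      by (intro closed_Collect_imp closed_Collect_eq continuous_intros open_Collect_const)
    moreover have "closed {F :: real ^ 'a ^ 'a. x \<in> V \<longrightarrow> N x \<noteq> {} \<longrightarrow>
        vec_restrict (F $ x) (N x) \<in> (\<lambda>g. (F $ x $ x) *\<^sub>R g) ` L x}" for x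
      using link_closed[of x] by (cases "x \<in> V \<and> N x \<noteq> {}") auto
    moreover have "closed {F :: real ^ 'a ^ 'a. pos_semidef (bordered F)}"
      unfolding pos_semidef_bordered_iff
      by (intro closed_Collect_conj closed_Collect_all closed_Collect_eq closed_Collect_le
          continuous_intros)
    ultimately show ?thesis
      unfolding \<F>_def Ball_def by (intro closed_Collect_conj closed_Collect_all)
  qed
  ultimately have "compact \<F>" by (simp add: compact_eq_bounded_closed)
  then show ?case
    unfolding TH by (intro compact_continuous_image continuous_intros)
qed

text \<open>
  For x outside I the row of the rank-one witness vanishes, and it is 0 times the characteristic
  vector of the empty set; that vector lies in the theta body of the link because the empty set is
  independent, which is where edges have to be nonempty.
\<close>

lemma char_vec_in_TH:
  assumes "1 \<le> r" "{} \<notin> E" "indep_set V E I"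
  shows "char_vec I \<in> TH r V E"
  using assms
proof (induction r V E arbitrary: I rule: TH.induct)
  case (2 V E)
  then show ?case by (auto simp: IND_def intro: hull_inc)
next
  case (3 k V E)
  define F :: "real ^ 'a ^ 'a" where "F = (\<chi> x y. indicator I x * indicator I y)"
  have I: "I \<subseteq> V" using 3 by (simp add: indep_set_def)
  have link: "vec_restrict (F $ x) (link_verts V E x) \<in> (\<lambda>g. (F $ x $ x) *\<^sub>R g)
                  ` TH (Suc k) (link_verts V E x) (link_edges (Suc (Suc k)) V E x)"
    if x: "x \<in> V" "link_verts V E x \<noteq> {}" for x
  proof (rule image_eqI)
    have empty: "{} \<notin> link_edges (Suc (Suc k)) V E x"
      by (auto simp: link_edges_def nsets_def)
    define J where "J = (if x \<in> I then I \<inter> link_verts V E x else {})"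
    have "indep_set (link_verts V E x) (link_edges (Suc (Suc k)) V E x) J"
      using 3(4) empty by (auto simp: J_def indep_set_def link_edges_def)
    then show "char_vec J \<in> TH (Suc k) (link_verts V E x) (link_edges (Suc (Suc k)) V E x)"
      using 3(1)[OF x] empty by simp
    show "vec_restrict (F $ x) (link_verts V E x) = (F $ x $ x) *\<^sub>R char_vec J"
      by (auto simp: vec_eq_iff vec_restrict_def F_def char_vec_def J_def indicator_def)
  qed
  have "pos_semidef (bordered F)"
    unfolding pos_semidef_bordered_iff
  proof (intro conjI allI)
    fix c :: real and v :: "'a \<Rightarrow> real"
    have "(\<Sum>x\<in>UNIV. \<Sum>y\<in>UNIV. F $ x $ y * (v x * v y)) = (\<Sum>x\<in>UNIV. F $ x $ x * v x)\<^sup>2"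
      unfolding power2_eq_square sum_product
      by (intro sum.cong refl) (simp add: F_def indicator_def)
    then have "c\<^sup>2 + 2 * c * (\<Sum>x\<in>UNIV. F $ x $ x * v x)
          + (\<Sum>x\<in>UNIV. \<Sum>y\<in>UNIV. F $ x $ y * (v x * v y)) = (c + (\<Sum>x\<in>UNIV. F $ x $ x * v x))\<^sup>2"
      by (simp add: power2_sum)
    then show "0 \<le> c\<^sup>2 + 2 * c * (\<Sum>x\<in>UNIV. F $ x $ x * v x)
          + (\<Sum>x\<in>UNIV. \<Sum>y\<in>UNIV. F $ x $ y * (v x * v y))" by simp
  qed (simp add: F_def)
  moreover have "\<forall>x y. x \<notin> V \<or> y \<notin> V \<longrightarrow> F $ x $ y = 0"
    using I by (auto simp: F_def indicator_def)
  moreover have "char_vec I = (\<chi> x. F $ x $ x)"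
    by (simp add: vec_eq_iff char_vec_def F_def indicator_def)
  ultimately show ?case using link unfolding TH.simps by blast
qed simp

text \<open>
  Turns the greatest-element description of the theta number into a maximum over the theta body,
  which is nonempty since it contains the zero vector.
\<close>

lemma theta_number_attained:
  assumes "1 \<le> r" "{} \<notin> E"
  obtains f where "f \<in> TH r V E" "theta_number r V E w = w \<bullet> f"
    "\<And>g. g \<in> TH r V E \<Longrightarrow> w \<bullet> g \<le> theta_number r V E w"
proof -
  have "char_vec {} \<in> TH r V E"
    using assms by (intro char_vec_in_TH) (auto simp: indep_set_def)
  then obtain f where f: "f \<in> TH r V E" "\<And>g. g \<in> TH r V E \<Longrightarrow> w \<bullet> g \<le> w \<bullet> f"
    using continuous_attains_sup[OF compact_TH, of r V E "\<lambda>f. w \<bullet> f"]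
      continuous_on_inner[OF continuous_on_const continuous_on_id] by blast
  then have "theta_number r V E w = w \<bullet> f"
    unfolding theta_number_def by (intro Greatest_equality) auto
  then show ?thesis using f that by simp
qed

lemma independence_number_le_theta_number:
  assumes "1 \<le> r" "{} \<notin> E"
  shows "independence_number V E w \<le> theta_number r V E w"
proof -
  have fin: "finite {I. indep_set V E I}" by simp
  have "indep_set V E {}" using assms by (auto simp: indep_set_def)
  moreover have "(\<Sum>x\<in>I. w $ x) \<le> theta_number r V E w" if "indep_set V E I" for I
  proof -
    have "(\<Sum>x\<in>I. w $ x) = w \<bullet> char_vec I"
      by (simp add: inner_vec_def char_vec_def indicator_def if_distrib sum.If_cases cong: if_cong)
    then show ?thesis
      using theta_number_attained[OF assms] char_vec_in_TH[OF assms that] by metis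
  qed
  ultimately show ?thesis
    unfolding independence_number_def by (subst Max_le_iff) auto
qed

section \<open>The smallest eigenvalue of a self-adjoint operator\<close>

text \<open>
  A minimiser u of the Rayleigh quotient on the unit sphere is an eigenvector: if m is the minimum,
  then the form \<open>(f, T f) - m (f, f)\<close> is nonnegative and vanishes at u, so its polarisation
  against u vanishes in every direction, in particular in the direction \<open>T u - m u\<close>.  Every other
  eigenvalue is the Rayleigh quotient of an eigenvector and is therefore at least m.  The weights are
  positive only on V, so all the vectors are required to vanish outside V.
\<close>

lemma least_eigenvalue_rayleigh:
  fixes T :: "real ^ 'a \<Rightarrow> real ^ 'a::finite" and w :: "'a \<Rightarrow> real"
  assumes lin: "linear T"
    and off: "\<And>f x. x \<notin> V \<Longrightarrow> T f $ x = 0"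
    and w: "\<And>x. x \<in> V \<Longrightarrow> 0 < w x"
    and V: "V \<noteq> {}"
    and sa: "\<And>f g. (\<Sum>x\<in>V. w x * (f $ x * T g $ x)) = (\<Sum>x\<in>V. w x * (g $ x * T f $ x))"
    and g: "\<And>x. x \<notin> V \<Longrightarrow> g $ x = 0"
  shows "(LEAST t. \<exists>f. f \<noteq> 0 \<and> (\<forall>x. x \<notin> V \<longrightarrow> f $ x = 0) \<and> T f = t *\<^sub>R f)
            * (\<Sum>x\<in>V. w x * (g $ x)\<^sup>2) \<le> (\<Sum>x\<in>V. w x * (g $ x * T g $ x))"
proof -
  define B where "B f h = (\<Sum>x\<in>V. w x * (f $ x * T h $ x))" for f h
  define N where "N f h = (\<Sum>x\<in>V. w x * (f $ x * h $ x))" for f h :: "real ^ 'a"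
  define W where "W = {f :: real ^ 'a. \<forall>x. x \<notin> V \<longrightarrow> f $ x = 0}"
  have N_pos: "0 < N f f" if "f \<in> W" "f \<noteq> 0" for f
  proof -
    obtain x where x: "f $ x \<noteq> 0" using \<open>f \<noteq> 0\<close> by (auto simp: vec_eq_iff)
    have "x \<in> V" using x \<open>f \<in> W\<close> by (auto simp: W_def)
    have "0 \<le> w i * (f $ i * f $ i)" if "i \<in> V" for i
      using w[OF that] by simp
    moreover have "0 < w x * (f $ x * f $ x)"
      using w[OF \<open>x \<in> V\<close>] x by (auto simp: zero_less_mult_iff)
    ultimately show ?thesis unfolding N_def
      using \<open>x \<in> V\<close> by (intro sum_pos2[of V x]) auto
  qed
  have T_add: "T (f + s *\<^sub>R h) = T f + s *\<^sub>R T h" for f h s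
    using lin by (simp add: linear_add linear_scale)
  have B_sym: "B f h = B h f" for f h unfolding B_def by (rule sa)
  have B_shift: "B (f + s *\<^sub>R h) (f + s *\<^sub>R h) = B f f + 2 * s * B h f + s\<^sup>2 * B h h" for f h s
  proof -
    have "B (f + s *\<^sub>R h) (f + s *\<^sub>R h) = B f f + s * B f h + s * B h f + s\<^sup>2 * B h h"
      unfolding B_def T_add sum_distrib_left sum.distrib[symmetric]
      by (intro sum.cong refl) (simp add: algebra_simps power2_eq_square)
    then show ?thesis using B_sym[of f h] by simp
  qed
  have N_shift: "N (f + s *\<^sub>R h) (f + s *\<^sub>R h) = N f f + 2 * s * N h f + s\<^sup>2 * N h h" for f h s
    unfolding N_def sum_distrib_left sum.distrib[symmetric]
    by (intro sum.cong refl) (simp add: algebra_simps power2_eq_square)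
  have contT: "continuous_on S T" for S
    using lin linear_continuous_on linear_conv_bounded_linear by blast
  define S where "S = W \<inter> sphere 0 1"
  have "compact S"
  proof -
    have "closed W"
      unfolding W_def by (intro closed_Collect_all closed_Collect_imp closed_Collect_eq
          continuous_intros open_Collect_const)
    then show ?thesis unfolding S_def by (intro closed_Int_compact) auto
  qed
  obtain v where "v \<in> V" using V by blast
  then have "axis v 1 \<in> S" by (auto simp: S_def W_def axis_nth norm_axis_1) (auto simp: axis_def)
  moreover have "continuous_on S (\<lambda>f. B f f / N f f)"
    unfolding B_def N_def
    by (intro continuous_intros contT ballI)
       (use N_pos in \<open>fastforce simp: S_def N_def\<close>)
  ultimately obtain u where u: "u \<in> S" and min: "\<And>f. f \<in> S \<Longrightarrow> B u u / N u u \<le> B f f / N f f"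
    using continuous_attains_inf[OF \<open>compact S\<close>, of "\<lambda>f. B f f / N f f"] by blast
  define m where "m = B u u / N u u"
  have u': "u \<in> W" "u \<noteq> 0" using u by (auto simp: S_def)
  have Buu: "B u u = m * N u u" using N_pos[OF u'] by (simp add: m_def)
  have ray: "m * N f f \<le> B f f" if "f \<in> W" for f
  proof (cases "f = 0")
    case True
    then show ?thesis by (simp add: B_def N_def)
  next
    case False
    define c where "c = inverse (norm f)"
    have "c \<noteq> 0" using False by (simp add: c_def)
    have "c *\<^sub>R f \<in> S" using False that by (auto simp: S_def W_def c_def)
    then have "m \<le> B (c *\<^sub>R f) (c *\<^sub>R f) / N (c *\<^sub>R f) (c *\<^sub>R f)" unfolding m_def by (rule min)
    also have "B (c *\<^sub>R f) (c *\<^sub>R f) = c\<^sup>2 * B f f"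
      using B_shift[of 0 c f] linear_0[OF lin] by (simp add: B_def)
    also have "N (c *\<^sub>R f) (c *\<^sub>R f) = c\<^sup>2 * N f f"
      using N_shift[of 0 c f] by (simp add: N_def)
    finally show ?thesis using \<open>c \<noteq> 0\<close> N_pos[OF that False] by (simp add: field_simps)
  qed
  define h where "h = T u - m *\<^sub>R u"
  have hW: "h \<in> W" using u' off by (auto simp: h_def W_def)
  have "B h u - m * N h u = 0"
  proof (rule nonneg_quadratic_imp_linear_coeff_zero)
    fix s
    have "u + s *\<^sub>R h \<in> W" using u' hW by (auto simp: W_def)
    from ray[OF this] show "0 \<le> 2 * s * (B h u - m * N h u) + s\<^sup>2 * (B h h - m * N h h)"
      unfolding B_shift N_shift Buu by (simp add: algebra_simps)
  qed
  moreover have "B h u - m * N h u = N h h"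
    unfolding B_def N_def sum_distrib_left sum_subtractf[symmetric]
    by (intro sum.cong refl) (simp add: h_def algebra_simps)
  ultimately have "h = 0" using N_pos[OF hW] by force
  then have eigen: "T u = m *\<^sub>R u" by (simp add: h_def)
  have "(LEAST t. \<exists>f. f \<noteq> 0 \<and> (\<forall>x. x \<notin> V \<longrightarrow> f $ x = 0) \<and> T f = t *\<^sub>R f) = m"
  proof (rule Least_equality)
    show "\<exists>f. f \<noteq> 0 \<and> (\<forall>x. x \<notin> V \<longrightarrow> f $ x = 0) \<and> T f = m *\<^sub>R f"
      using u' eigen by (auto simp: W_def)
  next
    fix t assume "\<exists>f. f \<noteq> 0 \<and> (\<forall>x. x \<notin> V \<longrightarrow> f $ x = 0) \<and> T f = t *\<^sub>R f"
    then obtain f where f: "f \<noteq> 0" "f \<in> W" "T f = t *\<^sub>R f" by (auto simp: W_def)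
    have "B f f = t * N f f"
      unfolding B_def N_def f(3) sum_distrib_left by (intro sum.cong refl) simp
    then show "m \<le> t" using ray[OF f(2)] N_pos[OF f(2,1)] by simp
  qed
  moreover have "g \<in> W" using g by (simp add: W_def)
  ultimately show ?thesis using ray[of g] by (simp add: B_def N_def power2_eq_square)
qed

section \<open>The inductive step of the Hoffman bound\<close>

text \<open>
  The comparison of the two estimates, for an arbitrary symmetric kernel K with row sums w.  The
  number l plays the role of the smallest eigenvalue and h that of the bound on the links.  The
  signs of l and h are used to divide by 1 - l and to settle the case in which the left-hand side
  is 0.
\<close>

lemma hoffman_bound_step:
  fixes F :: "real ^ 'a ^ 'a::finite" and w :: "'a \<Rightarrow> real" and K :: "'a \<Rightarrow> 'a \<Rightarrow> real"
  assumes K_sym: "\<And>x y. K x y = K y x" and K_row: "\<And>x. (\<Sum>y\<in>UNIV. K x y) = w x"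
    and w_nonneg: "\<And>x. 0 \<le> w x" and w_sum: "(\<Sum>x\<in>UNIV. w x) = 1"
    and rayleigh: "\<And>g. l * (\<Sum>x\<in>UNIV. w x * (g x)\<^sup>2) \<le> (\<Sum>x\<in>UNIV. \<Sum>y\<in>UNIV. K x y * (g x * g y))"
    and l: "l \<le> 0" and h: "0 \<le> h"
    and psd: "pos_semidef (bordered F)"
    and row: "\<And>x. (\<Sum>y\<in>UNIV. K x y * F $ x $ y) \<le> h * (w x * F $ x $ x)"
  shows "(\<Sum>x\<in>UNIV. w x * F $ x $ x) \<le> 1 - (1 - h) / (1 - l)"
proof -
  define t where "t = (\<Sum>x\<in>UNIV. w x * F $ x $ x)"
  have F: "pos_semidef F" by (rule pos_semidef_bordered_imp[OF psd])
  have "0 \<le> t"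
    unfolding t_def by (intro sum_nonneg mult_nonneg_nonneg w_nonneg pos_semidef_diag_nonneg[OF F])
  define P where "P x y = K x y - (if y = x then l * w x else 0) - (1 - l) * (w x * w y)" for x y
  have expand: "(\<Sum>x\<in>UNIV. \<Sum>y\<in>UNIV. P x y * G x y) = (\<Sum>x\<in>UNIV. \<Sum>y\<in>UNIV. K x y * G x y)
      - l * (\<Sum>x\<in>UNIV. w x * G x x) - (1 - l) * (\<Sum>x\<in>UNIV. \<Sum>y\<in>UNIV. w x * w y * G x y)"
    for G :: "'a \<Rightarrow> 'a \<Rightarrow> real"
  proof -
    have "P x y * G x y = K x y * G x y - (if y = x then l * (w x * G x x) else 0)
        - (1 - l) * (w x * w y * G x y)" for x y
      by (simp add: P_def algebra_simps)
    then show ?thesis by (simp add: sum_subtractf sum_distrib_left)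
  qed
  \<comment> \<open>Subtracting the mean c from g projects it to the orthogonal complement of the constants.\<close>
  have "0 \<le> (\<Sum>x\<in>UNIV. \<Sum>y\<in>UNIV. P x y * (g x * g y))" for g
  proof -
    define c where "c = (\<Sum>x\<in>UNIV. w x * g x)"
    have ww: "(\<Sum>x\<in>UNIV. \<Sum>y\<in>UNIV. w x * w y * (g x * g y)) = c\<^sup>2"
      unfolding c_def power2_eq_square sum_product by (intro sum.cong refl) simp
    have norm_shift: "(\<Sum>x\<in>UNIV. w x * (g x - c)\<^sup>2) = (\<Sum>x\<in>UNIV. w x * (g x)\<^sup>2) - c\<^sup>2"
    proof -
      have "(\<Sum>x\<in>UNIV. w x * (g x - c)\<^sup>2) =
          (\<Sum>x\<in>UNIV. w x * (g x)\<^sup>2) - 2 * c * (\<Sum>x\<in>UNIV. w x * g x) + c\<^sup>2 * (\<Sum>x\<in>UNIV. w x)"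
        unfolding sum_distrib_left sum.distrib[symmetric] sum_subtractf[symmetric]
        by (intro sum.cong refl) (simp add: algebra_simps power2_eq_square)
      then show ?thesis by (simp add: c_def[symmetric] w_sum power2_eq_square)
    qed
    have form_shift: "(\<Sum>x\<in>UNIV. \<Sum>y\<in>UNIV. K x y * ((g x - c) * (g y - c)))
        = (\<Sum>x\<in>UNIV. \<Sum>y\<in>UNIV. K x y * (g x * g y)) - c\<^sup>2"
    proof -
      have "(\<Sum>x\<in>UNIV. \<Sum>y\<in>UNIV. K x y * ((g x - c) * (g y - c)))
        = (\<Sum>x\<in>UNIV. \<Sum>y\<in>UNIV. K x y * (g x * g y)) - c * (\<Sum>x\<in>UNIV. \<Sum>y\<in>UNIV. K x y * g x)
           - c * (\<Sum>x\<in>UNIV. \<Sum>y\<in>UNIV. K x y * g y) + c\<^sup>2 * (\<Sum>x\<in>UNIV. \<Sum>y\<in>UNIV. K x y)"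
        unfolding sum_distrib_left sum.distrib[symmetric] sum_subtractf[symmetric]
        by (intro sum.cong refl) (simp add: algebra_simps power2_eq_square)
      moreover have "(\<Sum>x\<in>UNIV. \<Sum>y\<in>UNIV. K x y * g x) = c"
        by (simp add: c_def K_row sum_distrib_right[symmetric])
      moreover have "(\<Sum>x\<in>UNIV. \<Sum>y\<in>UNIV. K x y * g y) = c"
        by (subst sum.swap, subst K_sym) (simp add: c_def K_row sum_distrib_right[symmetric])
      ultimately show ?thesis by (simp add: K_row w_sum power2_eq_square)
    qed
    show ?thesis
      using rayleigh[of "\<lambda>x. g x - c"] unfolding norm_shift form_shift expand ww
      by (simp add: algebra_simps power2_eq_square)
  qed
  from trace_product_nonneg[OF F this]
  have "l * t + (1 - l) * (\<Sum>x\<in>UNIV. \<Sum>y\<in>UNIV. w x * w y * F $ x $ y)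
      \<le> (\<Sum>x\<in>UNIV. \<Sum>y\<in>UNIV. K x y * F $ x $ y)"
    unfolding expand by (simp add: t_def)
  also have "\<dots> \<le> (\<Sum>x\<in>UNIV. h * (w x * F $ x $ x))" by (intro sum_mono row)
  also have "\<dots> = h * t" by (simp add: t_def sum_distrib_left)
  finally have upper: "l * t + (1 - l) * (\<Sum>x\<in>UNIV. \<Sum>y\<in>UNIV. w x * w y * F $ x $ y) \<le> h * t" .
  \<comment> \<open>The bordered matrix evaluated at -t on the border and at w elsewhere.\<close>
  have "0 \<le> (- t)\<^sup>2 + 2 * (- t) * (\<Sum>x\<in>UNIV. F $ x $ x * w x)
        + (\<Sum>x\<in>UNIV. \<Sum>y\<in>UNIV. F $ x $ y * (w x * w y))"
    using psd unfolding pos_semidef_bordered_iff by blast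
  then have "t\<^sup>2 \<le> (\<Sum>x\<in>UNIV. \<Sum>y\<in>UNIV. w x * w y * F $ x $ y)"
    by (simp add: t_def mult.commute power2_eq_square)
  then have "(1 - l) * t\<^sup>2 \<le> (1 - l) * (\<Sum>x\<in>UNIV. \<Sum>y\<in>UNIV. w x * w y * F $ x $ y)"
    using l by (intro mult_left_mono) auto
  with upper have key: "(l + (1 - l) * t) * t \<le> h * t" by (simp add: algebra_simps power2_eq_square)
  have "l + (1 - l) * t \<le> h"
  proof (cases "t = 0")
    case True
    then show ?thesis using l h by simp
  next
    case False
    then show ?thesis using key \<open>0 \<le> t\<close> by simp
  qed
  then show ?thesis using l by (simp add: t_def[symmetric] field_simps)
qed

section \<open>Links of weighted hypergraphs\<close>

text \<open>
  The uniformity of a vertex link is \<open>r - 1\<close>; keeping this form lets the rules about links apply.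
\<close>

declare One_nat_def [simp del]

text \<open>
  All measures of the weighted theory are multiples of this function, and passing to a link
  amounts, up to normalisation, to enlarging its argument.
\<close>

definition codegree :: "('a::finite set \<Rightarrow> real) \<Rightarrow> 'a set \<Rightarrow> real" where
  "codegree \<mu> \<sigma> = (\<Sum>e | \<sigma> \<subseteq> e. \<mu> e)"

lemma sum_edges_eq_codegree: "(\<Sum>e\<in>{e \<in> edges \<mu>. \<sigma> \<subseteq> e}. \<mu> e) = codegree \<mu> \<sigma>"
  unfolding codegree_def by (intro sum.mono_neutral_left) (auto simp: edges_def)

lemma codegree_outside:
  assumes "\<And>e. \<mu> e \<noteq> 0 \<Longrightarrow> e \<subseteq> V" "\<not> \<sigma> \<subseteq> V"
  shows "codegree \<mu> \<sigma> = 0"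
  unfolding codegree_def using assms by (intro sum.neutral) auto

lemma codegree_nonneg: "(\<And>e. 0 \<le> \<mu> e) \<Longrightarrow> 0 \<le> codegree \<mu> \<sigma>"
  unfolding codegree_def by (intro sum_nonneg)

lemma codegree_pos:
  assumes "\<And>e. 0 \<le> \<mu> e" "\<mu> e \<noteq> 0" "\<sigma> \<subseteq> e"
  shows "0 < codegree \<mu> \<sigma>"
  unfolding codegree_def using assms order_le_neq_trans[of 0 "\<mu> e"]
  by (intro sum_pos2[of _ e]) auto

lemma codegree_nonzeroD: "codegree \<mu> \<sigma> \<noteq> 0 \<Longrightarrow> \<exists>e. \<mu> e \<noteq> 0 \<and> \<sigma> \<subseteq> e"
  unfolding codegree_def by (metis (mono_tags, lifting) mem_Collect_eq sum.neutral)

text \<open>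
  Double counting of the incidences between vertices and edges.
\<close>

lemma sum_codegree_singletons:
  fixes \<mu> :: "'a::finite set \<Rightarrow> real"
  assumes "\<And>e. \<mu> e \<noteq> 0 \<Longrightarrow> card e = k"
  shows "(\<Sum>x\<in>UNIV. codegree \<mu> {x}) = k * (\<Sum>e\<in>UNIV. \<mu> e)"
proof -
  have "(\<Sum>x\<in>UNIV. codegree \<mu> {x}) = (\<Sum>x\<in>UNIV. \<Sum>e\<in>UNIV. if x \<in> e then \<mu> e else 0)"
    by (simp add: codegree_def sum.If_cases)
  also have "\<dots> = (\<Sum>e\<in>UNIV. \<Sum>x\<in>UNIV. if x \<in> e then \<mu> e else 0)"
    by (rule sum.swap)
  also have "\<dots> = (\<Sum>e\<in>UNIV. k * \<mu> e)"
    using assms by (intro sum.cong refl) (auto simp: sum.If_cases)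
  finally show ?thesis by (simp add: sum_distrib_left)
qed

lemma level_measure_eq_codegree:
  "level_measure r V \<mu> i \<sigma> = (if \<sigma> \<in> nsets V i then codegree \<mu> \<sigma> / real (r choose i) else 0)"
  by (simp add: level_measure_def sum_edges_eq_codegree)

text \<open>
  The right-hand side does not mention V: this is why discarding isolated vertices of a link changes
  neither its vertex weights nor the set of its non-isolated vertices.
\<close>

lemma level_measure_1_eq_codegree:
  assumes "\<And>e. \<mu> e \<noteq> 0 \<Longrightarrow> e \<subseteq> V"
  shows "level_measure r V \<mu> 1 {y} = codegree \<mu> {y} / r"
  using codegree_outside[of \<mu> V "{y}", OF assms] by (auto simp: level_measure_eq_codegree nsets_def choose_one)

lemma level_eq_codegree:
  assumes "i \<le> r"
  shows "level r V \<mu> i = {\<sigma> \<in> nsets V i. codegree \<mu> \<sigma> \<noteq> 0}"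
  using assms by (auto simp: level_def level_measure_eq_codegree)

lemma nonisolated_eq_codegree:
  assumes "1 \<le> r" "\<And>e. \<mu> e \<noteq> 0 \<Longrightarrow> e \<subseteq> V"
  shows "nonisolated r V \<mu> = {y. codegree \<mu> {y} \<noteq> 0}"
  using assms(1) by (auto simp: nonisolated_def level_def level_measure_1_eq_codegree[OF assms(2)])

text \<open>
  The membership test for e is absorbed by the support of \<open>\<mu>\<close>.  With this form, links of
  links can be computed by rewriting.
\<close>

lemma link_measure_eq:
  assumes supp: "\<And>e. \<mu> e \<noteq> 0 \<Longrightarrow> e \<in> nsets V r" and \<sigma>: "\<sigma> \<subseteq> V" "card \<sigma> \<le> r"
  shows "link_measure r V \<mu> \<sigma> e = (if e \<inter> \<sigma> = {} then \<mu> (e \<union> \<sigma>) / codegree \<mu> \<sigma> else 0)"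
proof -
  have "e \<in> nsets (V - \<sigma>) (r - card \<sigma>) \<longleftrightarrow> e \<inter> \<sigma> = {} \<and> e \<union> \<sigma> \<in> nsets V r"
    using \<sigma> card_Un_disjoint[of e \<sigma>] by (cases "e \<inter> \<sigma> = {}") (auto simp: nsets_def)
  then show ?thesis
    using supp[of "e \<union> \<sigma>"] by (auto simp: link_measure_def sum_edges_eq_codegree)
qed

lemma codegree_link:
  fixes \<mu> :: "'a::finite set \<Rightarrow> real"
  assumes supp: "\<And>e. \<mu> e \<noteq> 0 \<Longrightarrow> e \<in> nsets V r" and \<sigma>: "\<sigma> \<subseteq> V" "card \<sigma> \<le> r"
  shows "codegree (link_measure r V \<mu> \<sigma>) \<tau> =
    (if \<tau> \<inter> \<sigma> = {} then codegree \<mu> (\<tau> \<union> \<sigma>) / codegree \<mu> \<sigma> else 0)"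
proof (cases "\<tau> \<inter> \<sigma> = {}")
  case True
  have "codegree (link_measure r V \<mu> \<sigma>) \<tau> =
      (\<Sum>e\<in>{e. \<tau> \<subseteq> e \<and> e \<inter> \<sigma> = {}}. \<mu> (e \<union> \<sigma>) / codegree \<mu> \<sigma>)"
    unfolding codegree_def[of "link_measure r V \<mu> \<sigma>"]
    by (intro sum.mono_neutral_cong_right) (auto simp: link_measure_eq[OF assms])
  also have "\<dots> = (\<Sum>e\<in>{e. \<tau> \<union> \<sigma> \<subseteq> e}. \<mu> e / codegree \<mu> \<sigma>)"
    using True by (intro sum.reindex_bij_witness[of _ "\<lambda>e. e - \<sigma>" "\<lambda>e. e \<union> \<sigma>"]) auto
  finally show ?thesis
    using True by (simp add: codegree_def[of \<mu> "\<tau> \<union> \<sigma>"] sum_divide_distrib)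
next
  case False
  then have "codegree (link_measure r V \<mu> \<sigma>) \<tau> = 0"
    unfolding codegree_def by (intro sum.neutral ballI) (auto simp: link_measure_eq[OF assms])
  with False show ?thesis by simp
qed

text \<open>
  The standing assumptions on a weighted hypergraph.  Uniformity 1 is included since the
  induction on the uniformity starts there.
\<close>

locale full_hypergraph =
  fixes r :: nat and V :: "'a::finite set" and \<mu> :: "'a set \<Rightarrow> real"
  assumes r_pos: "1 \<le> r"
    and weighted: "weighted_hypergraph r V \<mu>"
    and full: "nonisolated r V \<mu> = V"
begin

lemma mu_nonneg: "0 \<le> \<mu> e"
  using weighted by (simp add: weighted_hypergraph_def)

lemma mu_supp: "\<mu> e \<noteq> 0 \<Longrightarrow> e \<in> nsets V r"
  using weighted by (auto simp: weighted_hypergraph_def)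

lemma mu_subset: "\<mu> e \<noteq> 0 \<Longrightarrow> e \<subseteq> V" and mu_card: "\<mu> e \<noteq> 0 \<Longrightarrow> card e = r"
  using mu_supp[of e] by (auto simp: nsets_def)

lemma sum_mu: "(\<Sum>e\<in>UNIV. \<mu> e) = 1"
proof -
  have "(\<Sum>e\<in>nsets V r. \<mu> e) = (\<Sum>e\<in>UNIV. \<mu> e)"
    using mu_supp by (intro sum.mono_neutral_left) auto
  then show ?thesis using weighted by (simp add: weighted_hypergraph_def)
qed

lemma V_eq: "V = {x. codegree \<mu> {x} \<noteq> 0}"
  using full nonisolated_eq_codegree[OF r_pos mu_subset] by simp

lemma codegree_vertex_pos: "x \<in> V \<Longrightarrow> 0 < codegree \<mu> {x}"
  using V_eq codegree_nonneg[of \<mu> "{x}", OF mu_nonneg] by (simp add: less_le)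

lemma edge_exists: "\<exists>e. \<mu> e \<noteq> 0"
  using sum_mu by (metis sum.neutral zero_neq_one)

lemma V_nonempty: "V \<noteq> {}"
  using edge_exists mu_subset mu_card r_pos by fastforce

lemma level_nonempty:
  assumes "i \<le> r"
  shows "level r V \<mu> i \<noteq> {}"
proof -
  obtain e where e: "\<mu> e \<noteq> 0" using edge_exists by blast
  then obtain \<sigma> where "\<sigma> \<subseteq> e" "card \<sigma> = i"
    using mu_card[OF e] assms obtain_subset_with_card_n by metis
  then have "\<sigma> \<in> level r V \<mu> i"
    using codegree_pos[of \<mu> e \<sigma>, OF mu_nonneg e] mu_subset[OF e]
    by (auto simp: level_eq_codegree[OF assms] nsets_def)
  then show ?thesis by blast
qed

lemma vertex_weight_eq: "vertex_weight r V \<mu> $ x = codegree \<mu> {x} / r"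
  by (simp add: vertex_weight_def level_measure_1_eq_codegree[OF mu_subset])

lemma vertex_weight_nonneg: "0 \<le> vertex_weight r V \<mu> $ x"
  using codegree_nonneg[of \<mu> "{x}", OF mu_nonneg] by (simp add: vertex_weight_eq)

lemma vertex_weight_outside: "x \<notin> V \<Longrightarrow> vertex_weight r V \<mu> $ x = 0"
  unfolding vertex_weight_eq using V_eq by simp

lemma vertex_weight_sum: "(\<Sum>x\<in>UNIV. vertex_weight r V \<mu> $ x) = 1"
  using sum_codegree_singletons[of \<mu> r, OF mu_card] r_pos
  by (simp add: vertex_weight_eq sum_mu sum_divide_distrib[symmetric])

abbreviation link :: "'a \<Rightarrow> 'a set \<Rightarrow> real" where
  "link x \<equiv> link_measure r V \<mu> {x}"

abbreviation link_V :: "'a \<Rightarrow> 'a set" where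
  "link_V x \<equiv> nonisolated (r - 1) V (link x)"

lemma link_eq:
  assumes "x \<in> V"
  shows "link x e = (if x \<in> e then 0 else \<mu> (insert x e) / codegree \<mu> {x})"
  using link_measure_eq[of \<mu> V r "{x}" e, OF mu_supp] assms r_pos by simp

lemma codegree_vertex_link:
  assumes "x \<in> V"
  shows "codegree (link x) \<tau> = (if x \<in> \<tau> then 0 else codegree \<mu> (insert x \<tau>) / codegree \<mu> {x})"
  using codegree_link[of \<mu> V r "{x}" \<tau>, OF mu_supp] assms r_pos by simp

lemma link_supp: "link x e \<noteq> 0 \<Longrightarrow> e \<in> nsets (V - {x}) (r - 1)"
  by (auto simp: link_measure_def One_nat_def split: if_splits)

lemma link_V_eq:
  assumes "2 \<le> r"
  shows "link_V x = {y. codegree (link x) {y} \<noteq> 0}"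
  using link_supp assms by (intro nonisolated_eq_codegree) (auto simp: nsets_def)

text \<open>
  The link, with its isolated vertices removed, satisfies the standing assumptions again; this allows
  induction on the uniformity.
\<close>

lemma full_hypergraph_link:
  assumes x: "x \<in> V" and r: "2 \<le> r"
  shows "full_hypergraph (r - 1) (link_V x) (link x)"
proof -
  have nonneg: "0 \<le> link x e" for e
    using codegree_vertex_pos[OF x] mu_nonneg by (simp add: link_eq[OF x])
  have supp: "e \<in> nsets (link_V x) (r - 1)" if "link x e \<noteq> 0" for e
  proof -
    have "y \<in> link_V x" if "y \<in> e" for y
      using codegree_pos[of "link x" e "{y}", OF nonneg \<open>link x e \<noteq> 0\<close>] that by (simp add: link_V_eq[OF r])
    then show ?thesis using link_supp[OF that] by (auto simp: nsets_def)
  qed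
  have "(\<Sum>e\<in>nsets (link_V x) (r - 1). link x e) = codegree (link x) {}"
    unfolding codegree_def using supp by (intro sum.mono_neutral_left) auto
  also have "\<dots> = 1" using codegree_vertex_pos[OF x] by (simp add: codegree_vertex_link[OF x])
  finally have "weighted_hypergraph (r - 1) (link_V x) (link x)"
    using nonneg supp by (auto simp: weighted_hypergraph_def)
  moreover have "nonisolated (r - 1) (link_V x) (link x) = link_V x"
    using supp r by (subst nonisolated_eq_codegree) (auto simp: nsets_def link_V_eq[OF r])
  ultimately show ?thesis using r by unfold_locales auto
qed

lemma link_verts_edges:
  assumes x: "x \<in> V" and r: "2 \<le> r"
  shows "link_verts V (edges \<mu>) x = link_V x"
proof -
  have "y \<in> link_verts V (edges \<mu>) x \<longleftrightarrow> y \<in> link_V x" for y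
  proof
    assume "y \<in> link_verts V (edges \<mu>) x"
    then obtain e where "y \<noteq> x" "\<mu> e \<noteq> 0" "x \<in> e" "y \<in> e" by (auto simp: link_verts_def edges_def)
    then show "y \<in> link_V x"
      using codegree_pos[of \<mu> e "{x, y}", OF mu_nonneg] codegree_vertex_pos[OF x]
      by (simp add: link_V_eq[OF r] codegree_vertex_link[OF x])
  next
    assume "y \<in> link_V x"
    then have "y \<noteq> x" "codegree \<mu> {x, y} \<noteq> 0"
      by (auto simp: link_V_eq[OF r] codegree_vertex_link[OF x] split: if_splits)
    then show "y \<in> link_verts V (edges \<mu>) x"
      using codegree_nonzeroD[of \<mu> "{x, y}"] mu_subset by (auto simp: link_verts_def edges_def)
  qed
  then show ?thesis by blast
qed

text \<open>
  The links of the theta body are those of the underlying hypergraph, whereas the Hoffman bound refers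
  to weighted links.  Together with the previous lemma this says that the two notions agree.
\<close>

lemma link_edges_edges:
  assumes x: "x \<in> V" and r: "2 \<le> r"
  shows "link_edges r V (edges \<mu>) x = edges (link x)"
proof -
  interpret L: full_hypergraph "r - 1" "link_V x" "link x" by (rule full_hypergraph_link[OF x r])
  have "e \<in> link_edges r V (edges \<mu>) x \<longleftrightarrow> link x e \<noteq> 0" for e
  proof
    assume "e \<in> link_edges r V (edges \<mu>) x"
    then have "\<mu> (insert x e) \<noteq> 0" "x \<notin> e"
      by (auto simp: link_edges_def edges_def link_verts_def nsets_def)
    then show "link x e \<noteq> 0" using codegree_vertex_pos[OF x] by (simp add: link_eq[OF x])
  next
    assume e: "link x e \<noteq> 0"
    then have "\<mu> (insert x e) \<noteq> 0" by (auto simp: link_eq[OF x] split: if_splits)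
    then show "e \<in> link_edges r V (edges \<mu>) x"
      using L.mu_supp[OF e] unfolding link_edges_def link_verts_edges[OF x r]
      by (simp add: edges_def)
  qed
  then show ?thesis by (auto simp: edges_def)
qed

section \<open>The adjacency operator and the link eigenvalues\<close>

text \<open>
  The symmetric kernel of the quadratic form of the normalized adjacency operator: half of the measure
  that \<open>\<mu>\<close> induces on the pairs of vertices.
\<close>

definition pair_weight :: "'a \<Rightarrow> 'a \<Rightarrow> real" where
  "pair_weight x y = (if x = y then 0 else codegree \<mu> {x, y} / (r * (r - 1)))"

lemma pair_weight_sym: "pair_weight x y = pair_weight y x"
  by (simp add: pair_weight_def insert_commute)

lemma pair_weight_outside: "x \<notin> V \<Longrightarrow> pair_weight x y = 0"
  using codegree_outside[of \<mu> V "{x, y}", OF mu_subset] by (simp add: pair_weight_def)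

lemma vertex_weight_link:
  assumes x: "x \<in> V" and r: "2 \<le> r"
  shows "vertex_weight r V \<mu> $ x * vertex_weight (r - 1) (link_V x) (link x) $ y = pair_weight x y"
proof -
  interpret L: full_hypergraph "r - 1" "link_V x" "link x" by (rule full_hypergraph_link[OF x r])
  show ?thesis
    using codegree_vertex_pos[OF x] r
    by (auto simp: vertex_weight_eq L.vertex_weight_eq codegree_vertex_link[OF x] pair_weight_def
        of_nat_diff)
qed

lemma pair_weight_row:
  assumes "2 \<le> r"
  shows "(\<Sum>y\<in>UNIV. pair_weight x y) = vertex_weight r V \<mu> $ x"
proof (cases "x \<in> V")
  case True
  interpret L: full_hypergraph "r - 1" "link_V x" "link x" by (rule full_hypergraph_link[OF True assms])
  show ?thesis
    by (simp add: vertex_weight_link[OF True assms, symmetric] sum_distrib_left[symmetric]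
        L.vertex_weight_sum)
next
  case False
  then show ?thesis by (simp add: pair_weight_outside vertex_weight_outside)
qed

lemma adj_op_eq:
  assumes r: "2 \<le> r"
  shows "vertex_weight r V \<mu> $ x * adj_op r V \<mu> f $ x = (\<Sum>y\<in>V. pair_weight x y * f $ y)"
proof (cases "x \<in> V")
  case True
  interpret L: full_hypergraph "r - 1" "link_V x" "link x" by (rule full_hypergraph_link[OF True r])
  have "level_measure (r - 1) V (link x) 1 {y} = vertex_weight (r - 1) (link_V x) (link x) $ y" for y
    unfolding L.vertex_weight_eq using link_supp by (intro level_measure_1_eq_codegree) (auto simp: nsets_def)
  then show ?thesis
    using True by (simp add: adj_op_def sum_distrib_left vertex_weight_link[OF True r, symmetric]
        algebra_simps)
next
  case False
  then show ?thesis by (simp add: pair_weight_outside vertex_weight_outside)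
qed

text \<open>
  Since the weights and the kernel vanish outside V, it is enough to consider the part
  of g that is supported on V.
\<close>

lemma smallest_eigenvalue_rayleigh:
  assumes r: "2 \<le> r"
  shows "smallest_eigenvalue r V \<mu> * (\<Sum>x\<in>UNIV. vertex_weight r V \<mu> $ x * (g x)\<^sup>2)
     \<le> (\<Sum>x\<in>UNIV. \<Sum>y\<in>UNIV. pair_weight x y * (g x * g y))"
proof -
  let ?w = "\<lambda>x. vertex_weight r V \<mu> $ x"
  define f :: "real ^ 'a" where "f = (\<chi> x. if x \<in> V then g x else 0)"
  have form: "(\<Sum>x\<in>V. ?w x * (f $ x * adj_op r V \<mu> h $ x)) = (\<Sum>x\<in>V. \<Sum>y\<in>V. pair_weight x y * (f $ x * h $ y))"
    for f h
  proof (intro sum.cong refl)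
    fix x
    have "?w x * (f $ x * adj_op r V \<mu> h $ x) = f $ x * (?w x * adj_op r V \<mu> h $ x)" by simp
    then show "?w x * (f $ x * adj_op r V \<mu> h $ x) = (\<Sum>y\<in>V. pair_weight x y * (f $ x * h $ y))"
      unfolding adj_op_eq[OF r] by (simp add: sum_distrib_left algebra_simps)
  qed
  have "smallest_eigenvalue r V \<mu> * (\<Sum>x\<in>V. ?w x * (f $ x)\<^sup>2)
      \<le> (\<Sum>x\<in>V. ?w x * (f $ x * adj_op r V \<mu> f $ x))"
    unfolding smallest_eigenvalue_def is_eigenvalue_def
  proof (rule least_eigenvalue_rayleigh)
    show "linear (adj_op r V \<mu>)"
      by (rule linearI)
        (auto simp: vec_eq_iff adj_op_def algebra_simps sum.distrib sum_distrib_left)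
    show "0 < ?w x" if "x \<in> V" for x
      using codegree_vertex_pos[OF that] r by (simp add: vertex_weight_eq)
    show "(\<Sum>x\<in>V. ?w x * (f $ x * adj_op r V \<mu> h $ x)) = (\<Sum>x\<in>V. ?w x * (h $ x * adj_op r V \<mu> f $ x))"
      for f h
      unfolding form
      by (subst sum.swap, subst pair_weight_sym) (simp add: mult.commute)
  qed (use V_nonempty in \<open>auto simp: adj_op_def f_def\<close>)
  also have "(\<Sum>x\<in>V. ?w x * (f $ x * adj_op r V \<mu> f $ x)) = (\<Sum>x\<in>UNIV. \<Sum>y\<in>UNIV. pair_weight x y * (g x * g y))"
  proof -
    have "(\<Sum>y\<in>UNIV. pair_weight x y * (g x * g y)) = (\<Sum>y\<in>V. pair_weight x y * (g x * g y))" for x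
      using pair_weight_outside pair_weight_sym[of x] by (intro sum.mono_neutral_right) auto
    moreover have "(\<Sum>x\<in>UNIV. \<Sum>y\<in>V. pair_weight x y * (g x * g y)) = (\<Sum>x\<in>V. \<Sum>y\<in>V. pair_weight x y * (g x * g y))"
      using pair_weight_outside by (intro sum.mono_neutral_right) auto
    ultimately show ?thesis unfolding form by (simp add: f_def cong: sum.cong)
  qed
  also have "(\<Sum>x\<in>V. ?w x * (f $ x)\<^sup>2) = (\<Sum>x\<in>UNIV. ?w x * (g x)\<^sup>2)"
    using vertex_weight_outside by (intro sum.mono_neutral_cong_left) (auto simp: f_def)
  finally show ?thesis .
qed

text \<open>
  A vertex is never its own neighbour, so the form of the adjacency operator vanishes at the
  characteristic vector of a single vertex.
\<close>

lemma smallest_eigenvalue_nonpos: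
  assumes r: "2 \<le> r"
  shows "smallest_eigenvalue r V \<mu> \<le> 0"
proof -
  obtain v where v: "v \<in> V" using V_nonempty by blast
  have "pair_weight x y * ((if x = v then 1 else 0) * (if y = v then 1 else 0)) = 0" for x y
    by (simp add: pair_weight_def)
  moreover have "(\<Sum>x\<in>UNIV. vertex_weight r V \<mu> $ x * (if x = v then 1 else 0)\<^sup>2) = vertex_weight r V \<mu> $ v"
  proof -
    have "vertex_weight r V \<mu> $ x * (if x = v then 1 else 0)\<^sup>2
        = (if x = v then vertex_weight r V \<mu> $ x else 0)" for x by simp
    then show ?thesis by simp
  qed
  ultimately have "smallest_eigenvalue r V \<mu> * vertex_weight r V \<mu> $ v \<le> 0"
    using smallest_eigenvalue_rayleigh[OF r, of "\<lambda>x. if x = v then 1 else 0"]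
    by (simp only: sum.neutral_const)
  then show ?thesis
    using codegree_vertex_pos[OF v] r by (simp add: vertex_weight_eq mult_le_0_iff divide_le_0_iff)
qed

text \<open>
  Iterated links are links: the normalising factor of the first link cancels.
\<close>

lemma link_of_link:
  assumes x: "x \<in> V" and r: "2 \<le> r" and \<sigma>: "\<sigma> \<subseteq> link_V x" "card \<sigma> + 1 \<le> r"
  shows "link_measure (r - 1) (link_V x) (link x) \<sigma> = link_measure r V \<mu> (insert x \<sigma>)"
proof
  fix e
  interpret L: full_hypergraph "r - 1" "link_V x" "link x" by (rule full_hypergraph_link[OF x r])
  have "x \<notin> \<sigma>" using \<sigma>(1) by (auto simp: link_V_eq[OF r] codegree_vertex_link[OF x])
  have "link_V x \<subseteq> V" by (auto simp: nonisolated_def level_def level_measure_def nsets_def split: if_splits)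
  then have sub: "insert x \<sigma> \<subseteq> V" using x \<sigma>(1) by blast
  have card: "card (insert x \<sigma>) \<le> r" using \<open>x \<notin> \<sigma>\<close> \<sigma>(2) by simp
  have "link_measure (r - 1) (link_V x) (link x) \<sigma> e
      = (if e \<inter> \<sigma> = {} then link x (e \<union> \<sigma>) / codegree (link x) \<sigma> else 0)"
    using L.mu_supp \<sigma> by (intro link_measure_eq) auto
  also have "\<dots> = (if e \<inter> insert x \<sigma> = {} then \<mu> (e \<union> insert x \<sigma>) / codegree \<mu> (insert x \<sigma>) else 0)"
    using \<open>x \<notin> \<sigma>\<close> codegree_vertex_pos[OF x] by (simp add: link_eq[OF x] codegree_vertex_link[OF x])
  also have "\<dots> = link_measure r V \<mu> (insert x \<sigma>) e"
    using link_measure_eq[of \<mu> V r "insert x \<sigma>" e, OF mu_supp sub card] by simp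
  finally show "link_measure (r - 1) (link_V x) (link x) \<sigma> e = link_measure r V \<mu> (insert x \<sigma>) e" .
qed

lemma link_smallest_eigenvalue_link:
  assumes x: "x \<in> V" and r: "2 \<le> r" and \<sigma>: "\<sigma> \<subseteq> link_V x" "card \<sigma> + 1 < r"
  shows "link_smallest_eigenvalue (r - 1) (link_V x) (link x) \<sigma>
       = link_smallest_eigenvalue r V \<mu> (insert x \<sigma>)"
proof -
  define \<nu> where "\<nu> = link_measure r V \<mu> (insert x \<sigma>)"
  have \<nu>: "link_measure (r - 1) (link_V x) (link x) \<sigma> = \<nu>"
    unfolding \<nu>_def using assms by (intro link_of_link) auto
  have "x \<notin> \<sigma>" using \<sigma>(1) by (auto simp: link_V_eq[OF r] codegree_vertex_link[OF x])
  then have card: "r - card (insert x \<sigma>) = r - 1 - card \<sigma>" by simp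
  have 1: "e \<subseteq> link_V x" if "\<nu> e \<noteq> 0" for e
    using that unfolding \<nu>[symmetric] by (auto simp: link_measure_def nsets_def split: if_splits)
  have 2: "e \<subseteq> V" if "\<nu> e \<noteq> 0" for e
    using that unfolding \<nu>_def by (auto simp: link_measure_def nsets_def split: if_splits)
  have "1 \<le> r - 1 - card \<sigma>" using \<sigma> by simp
  then have "nonisolated (r - 1 - card \<sigma>) (link_V x) \<nu> = nonisolated (r - 1 - card \<sigma>) V \<nu>"
    using nonisolated_eq_codegree[of _ \<nu> "link_V x"] nonisolated_eq_codegree[of _ \<nu> V] 1 2 by simp
  then show ?thesis
    unfolding link_smallest_eigenvalue_def Let_def \<nu> card \<nu>_def[symmetric] by simp
qed

text \<open>
  Each i-link of the link of x is the link of an (i+1)-set, so the minimum over the former ranges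
  over a subset of the values for the latter.  For i = 0 the link of x is itself one of these.
\<close>

lemma link_lambda_Suc_le:
  assumes x: "x \<in> V" and i: "i + 2 < r"
  shows "link_lambda r V \<mu> (Suc i) \<le> link_lambda (r - 1) (link_V x) (link x) i"
proof -
  have r: "2 \<le> r" using i by simp
  interpret L: full_hypergraph "r - 1" "link_V x" "link x" by (rule full_hypergraph_link[OF x r])
  have le: "link_lambda r V \<mu> (Suc i) \<le> link_smallest_eigenvalue r V \<mu> \<tau>"
    if "\<tau> \<in> level r V \<mu> (Suc i)" for \<tau>
    using that by (auto simp: link_lambda_def)
  show ?thesis
  proof (cases "i = 0")
    case True
    have "{x} \<in> level r V \<mu> (Suc i)"
      using True x codegree_vertex_pos[OF x] r by (auto simp: level_eq_codegree nsets_def)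
    from le[OF this] show ?thesis
      using True by (simp add: link_lambda_def link_smallest_eigenvalue_def Let_def One_nat_def)
  next
    case False
    have "link_lambda (r - 1) (link_V x) (link x) i
        \<in> link_smallest_eigenvalue (r - 1) (link_V x) (link x) ` level (r - 1) (link_V x) (link x) i"
      using False L.level_nonempty[of i] i unfolding link_lambda_def by simp
    then obtain \<sigma> where \<sigma>: "\<sigma> \<in> level (r - 1) (link_V x) (link x) i"
      and eq: "link_lambda (r - 1) (link_V x) (link x) i
             = link_smallest_eigenvalue (r - 1) (link_V x) (link x) \<sigma>" by blast
    have \<sigma>': "\<sigma> \<subseteq> link_V x" "card \<sigma> = i" "codegree (link x) \<sigma> \<noteq> 0"
      using \<sigma> i by (auto simp: level_eq_codegree nsets_def)
    have "x \<notin> \<sigma>" "codegree \<mu> (insert x \<sigma>) \<noteq> 0"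
      using \<sigma>'(3) by (auto simp: codegree_vertex_link[OF x] split: if_splits)
    moreover have "insert x \<sigma> \<subseteq> V"
      using codegree_outside[of \<mu> V "insert x \<sigma>", OF mu_subset] calculation by blast
    ultimately have "insert x \<sigma> \<in> level r V \<mu> (Suc i)"
      using \<sigma>' i by (simp add: level_eq_codegree nsets_def)
    from le[OF this] show ?thesis
      using link_smallest_eigenvalue_link[OF x r \<sigma>'(1)] \<sigma>'(2) i eq by simp
  qed
qed

end

section \<open>The upper bound\<close>

text \<open>
  Vertex links suffice for the induction: \<open>\<lambda>\<^sub>i\<^sub>+\<^sub>1\<close> is at most \<open>\<lambda>\<^sub>i\<close> of the link of any vertex.
\<close>

lemma link_lambda_nonpos:
  assumes "full_hypergraph r V \<mu>" "i + 2 \<le> r"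
  shows "link_lambda r V \<mu> i \<le> 0"
  using assms
proof (induction i arbitrary: r V \<mu>)
  case 0
  then interpret full_hypergraph r V \<mu> by simp
  show ?case using smallest_eigenvalue_nonpos 0 by (simp add: link_lambda_def)
next
  case (Suc i)
  then interpret full_hypergraph r V \<mu> by simp
  obtain x where x: "x \<in> V" using V_nonempty by blast
  have "link_lambda r V \<mu> (Suc i) \<le> link_lambda (r - 1) (link_V x) (link x) i"
    using Suc x by (intro link_lambda_Suc_le) auto
  also have "\<dots> \<le> 0"
    using Suc x by (intro Suc.IH full_hypergraph_link) auto
  finally show ?case .
qed

text \<open>
  For r = 1 the product is empty and the bound is 0; indeed every vertex is then an edge, so the
  only independent set is empty and the theta body is {0}.  In the inductive step the product over
  the links is compared factor by factor with the product of the factors of index at least 1 of the whole hypergraph.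
\<close>

lemma TH_le_hoffman:
  assumes "full_hypergraph r V \<mu>" "f \<in> TH r V (edges \<mu>)"
  shows "vertex_weight r V \<mu> \<bullet> f \<le> 1 - 1 / (\<Prod>i<r - 1. 1 - link_lambda r V \<mu> i)"
  using assms
proof (induction r arbitrary: V \<mu> f rule: less_induct)
  case (less r)
  interpret full_hypergraph r V \<mu> by fact
  consider "r = 1" | k where "r = Suc (Suc k)"
    using r_pos by (metis One_nat_def Suc_le_D not0_implies_Suc)
  then show ?case
  proof cases
    case 1
    have only_empty: "I = {}" if I: "indep_set V (edges \<mu>) I" for I
    proof (rule ccontr)
      assume "I \<noteq> {}"
      then obtain x where x: "x \<in> I" "x \<in> V" using I by (auto simp: indep_set_def)
      then obtain e where e: "\<mu> e \<noteq> 0" "x \<in> e"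
        using codegree_vertex_pos codegree_nonzeroD[of \<mu> "{x}"] by force
      then have "e = {x}" using mu_card[OF e(1)] 1 by (metis card_1_singletonE singletonD)
      then show False using I x e by (auto simp: indep_set_def edges_def)
    qed
    have "char_vec {} = (0 :: real ^ 'a)" by (simp add: char_vec_def vec_eq_iff)
    then have "char_vec ` {I. indep_set V (edges \<mu>) I} \<subseteq> {0}"
      by (auto dest!: only_empty)
    then have "convex hull (char_vec ` {I. indep_set V (edges \<mu>) I}) \<subseteq> {0 :: real ^ 'a}"
      by (intro hull_minimal) auto
    then have "f = 0" using less.prems 1 by (auto simp: IND_def One_nat_def)
    then show ?thesis using 1 by simp
  next
    case (2 k)
    then have r: "2 \<le> r" by simp
    let ?w = "vertex_weight r V \<mu>" and ?l = "link_lambda r V \<mu>"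
    define Q where "Q = (\<Prod>i<k. 1 - ?l (Suc i))"
    have l: "?l i \<le> 0" if "i < Suc k" for i
      using that 2 less.prems(1) by (intro link_lambda_nonpos) auto
    have Q: "1 \<le> Q" unfolding Q_def using l by (intro prod_ge_1) auto
    obtain F where psd: "pos_semidef (bordered F)" and f: "f = (\<chi> x. F $ x $ x)"
      and linkF: "\<And>x. x \<in> V \<Longrightarrow> link_verts V (edges \<mu>) x \<noteq> {} \<Longrightarrow>
           vec_restrict (F $ x) (link_verts V (edges \<mu>) x)
             \<in> (\<lambda>g. (F $ x $ x) *\<^sub>R g) ` TH (r - 1) (link_verts V (edges \<mu>) x) (link_edges r V (edges \<mu>) x)"
      using less.prems(2) unfolding 2 by auto
    have row: "(\<Sum>y\<in>UNIV. pair_weight x y * F $ x $ y) \<le> (1 - 1 / Q) * (?w $ x * F $ x $ x)" for x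
    proof (cases "x \<in> V")
      case False
      then show ?thesis by (simp add: pair_weight_outside vertex_weight_outside)
    next
      case x: True
      interpret L: full_hypergraph "r - 1" "link_V x" "link x" by (rule full_hypergraph_link[OF x r])
      let ?u = "vertex_weight (r - 1) (link_V x) (link x)"
      obtain g where g: "g \<in> TH (r - 1) (link_V x) (edges (link x))"
        and Fg: "vec_restrict (F $ x) (link_V x) = (F $ x $ x) *\<^sub>R g"
        using linkF[OF x] L.V_nonempty unfolding link_verts_edges[OF x r] link_edges_edges[OF x r]
        by blast
      define Q' where "Q' = (\<Prod>i<k. 1 - link_lambda (r - 1) (link_V x) (link x) i)"
      have "1 \<le> Q'"
        unfolding Q'_def using L.full_hypergraph_axioms 2
        by (intro prod_ge_1) (auto intro!: link_lambda_nonpos)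
      moreover have "Q' \<le> Q"
        unfolding Q_def Q'_def
      proof (intro prod_mono conjI)
        fix i assume i: "i \<in> {..<k}"
        show "0 \<le> 1 - link_lambda (r - 1) (link_V x) (link x) i"
          using link_lambda_nonpos[OF L.full_hypergraph_axioms, of i] i 2 by simp
        show "1 - link_lambda (r - 1) (link_V x) (link x) i \<le> 1 - ?l (Suc i)"
          using link_lambda_Suc_le[OF x, of i] i 2 by simp
      qed
      ultimately have mono: "1 - 1 / Q' \<le> 1 - 1 / Q" by (simp add: frac_le)
      have "?u \<bullet> g \<le> 1 - 1 / Q'"
        using less.IH[OF _ L.full_hypergraph_axioms g] 2 by (simp add: Q'_def)
      then have ug: "?u \<bullet> g \<le> 1 - 1 / Q" using mono by simp
      have "(\<Sum>y\<in>UNIV. pair_weight x y * F $ x $ y) = (\<Sum>y\<in>UNIV. ?w $ x * (?u $ y * F $ x $ y))"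
        by (simp add: vertex_weight_link[OF x r, symmetric] mult.assoc)
      also have "\<dots> = (\<Sum>y\<in>UNIV. ?w $ x * F $ x $ x * (?u $ y * g $ y))"
      proof (intro sum.cong refl)
        fix y
        show "?w $ x * (?u $ y * F $ x $ y) = ?w $ x * F $ x $ x * (?u $ y * g $ y)"
        proof (cases "y \<in> link_V x")
          case True
          then have "F $ x $ y = F $ x $ x * g $ y"
            using arg_cong[OF Fg, of "\<lambda>h. h $ y"] by (simp add: vec_restrict_def)
          then show ?thesis by simp
        qed (simp add: L.vertex_weight_outside)
      qed
      also have "\<dots> = ?w $ x * F $ x $ x * (?u \<bullet> g)"
        by (simp add: inner_vec_def sum_distrib_left)
      also have "\<dots> \<le> ?w $ x * F $ x $ x * (1 - 1 / Q)"
        using ug vertex_weight_nonneg pos_semidef_diag_nonneg[OF pos_semidef_bordered_imp[OF psd]]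
        by (intro mult_left_mono) auto
      finally show ?thesis by (simp add: mult.commute)
    qed
    have "(\<Sum>x\<in>UNIV. ?w $ x * F $ x $ x) \<le> 1 - (1 - (1 - 1 / Q)) / (1 - smallest_eigenvalue r V \<mu>)"
      using pair_weight_sym pair_weight_row[OF r] vertex_weight_nonneg vertex_weight_sum
        smallest_eigenvalue_rayleigh[OF r] smallest_eigenvalue_nonpos[OF r] _ psd row
      by (rule hoffman_bound_step) (use Q in simp)
    moreover have "(\<Prod>i<r - 1. 1 - ?l i) = (1 - smallest_eigenvalue r V \<mu>) * Q"
      by (simp add: 2 Q_def prod.lessThan_Suc_shift link_lambda_def[of _ _ _ 0] del: prod.lessThan_Suc)
    ultimately show ?thesis by (simp add: f inner_vec_def mult.commute)
  qed
qed

theorem theorem3p1: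
  fixes r :: nat and V :: "'a::finite set" and \<mu> :: "'a set \<Rightarrow> real"
  assumes "r \<ge> 2"
    and "weighted_hypergraph r V \<mu>"
    and "nonisolated r V \<mu> = V"
  shows "alpha r V \<mu> \<le> theta_number r V (edges \<mu>) (vertex_weight r V \<mu>)
       \<and> theta_number r V (edges \<mu>) (vertex_weight r V \<mu>) \<le> Hoff r V \<mu>"
proof
  interpret full_hypergraph r V \<mu> using assms by unfold_locales auto
  have no_empty: "{} \<notin> edges \<mu>"
    using mu_card[of "{}"] r_pos by (auto simp: edges_def)
  show "alpha r V \<mu> \<le> theta_number r V (edges \<mu>) (vertex_weight r V \<mu>)"
    unfolding alpha_def by (rule independence_number_le_theta_number[OF r_pos no_empty])
  obtain f where "f \<in> TH r V (edges \<mu>)"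
      and "theta_number r V (edges \<mu>) (vertex_weight r V \<mu>) = vertex_weight r V \<mu> \<bullet> f"
    using theta_number_attained[OF r_pos no_empty] by blast
  moreover have "{0..r - 2} = {..<r - 1}" using assms(1) by auto
  ultimately show "theta_number r V (edges \<mu>) (vertex_weight r V \<mu>) \<le> Hoff r V \<mu>"
    using TH_le_hoffman[OF full_hypergraph_axioms] unfolding Hoff_def by simp
qed

end
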